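(* Let $\phi\in\mathrm{J}_0$. Then either $\mathrm{C}(\phi)$ is contained in $\mathrm{J}$, or $\phi$ is periodic (i.e. of finite order).
   Context: $\mathrm{Bir}(\mathbb{P}^2)$ is the group of birational self-maps of $\mathbb{P}^2(\mathbb{C})$, and $\mathrm{C}(\phi)=\{\psi\in\mathrm{Bir}(\mathbb{P}^2)\mid\psi\phi=\phi\psi\}$. In an affine chart $(x,y)$, the de Jonquières group $\mathrm{J}\simeq\mathrm{PGL}_2(\mathbb{C}(y))\rtimes\mathrm{PGL}_2(\mathbb{C})$ is the group of all birational maps preserving the fibration $y=\text{const}$, i.e. maps of the form $\left(\frac{A(y)x+B(y)}{C(y)x+D(y)},\nu(y)\right)$ with $\begin{bmatrix}A&B\\C&D\end{bmatrix}\in\mathrm{PGL}_2(\mathbb{C}(y))$ and $\nu\in\mathrm{PGL}_2(\mathbb{C})$. $\mathrm{J}_0\simeq\mathrm{PGL}_2(\mathbb{C}(y))$ is the subgroup of those preserving the fibration fibre by fibre, i.e. with $\nu(y)=y$. *)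

theory Defs
  imports Complex_Main "HOL-Computational_Algebra.Computational_Algebra"
begin

section \<open>Homogeneous polynomials in three variables\<close>

text \<open>
  The ring \<open>\<complex>[X, Y, Z]\<close> is rendered as \<open>\<complex>[Z][Y][X]\<close>: the coefficient of \<open>X^i Y^j Z^k\<close> in \<open>P\<close> is
  \<open>coeff (coeff (coeff P i) j) k\<close>.
\<close>

type_synonym poly3 = "complex poly poly poly"

definition homogeneous :: "nat \<Rightarrow> poly3 \<Rightarrow> bool" where
  "homogeneous d P \<longleftrightarrow> (\<forall>i j k. coeff (coeff (coeff P i) j) k \<noteq> 0 \<longrightarrow> i + j + k = d)"

definition const3 :: "complex \<Rightarrow> poly3" where
  "const3 c = [:[:[:c:]:]:]"

definition varX :: poly3 where "varX = [:0, 1:]"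
definition varY :: poly3 where "varY = [:[:0, 1:]:]"
definition varZ :: poly3 where "varZ = [:[:[:0, 1:]:]:]"

text \<open>
  \<open>eval3 h (u, v, w) P\<close> is the value of \<open>P\<close> at \<open>X = u, Y = v, Z = w\<close> in a ring to which the complex
  numbers are mapped by the homomorphism \<open>h\<close>.
\<close>

definition eval1 :: "('a::zero \<Rightarrow> 'b::comm_ring_1) \<Rightarrow> 'b \<Rightarrow> 'a poly \<Rightarrow> 'b" where
  "eval1 h u P = poly (map_poly h P) u"

fun eval3 :: "(complex \<Rightarrow> 'b::comm_ring_1) \<Rightarrow> 'b \<times> 'b \<times> 'b \<Rightarrow> poly3 \<Rightarrow> 'b" where
  "eval3 h (u, v, w) P = eval1 (eval1 (eval1 h w) v) u P"

definition rhom :: "('a::comm_ring_1 \<Rightarrow> 'b::comm_ring_1) \<Rightarrow> bool" where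
  "rhom h \<longleftrightarrow> h 0 = 0 \<and> h 1 = 1 \<and> (\<forall>a b. h (a + b) = h a + h b) \<and> (\<forall>a b. h (a * b) = h a * h b)"

lemma rhomD:
  assumes "rhom h"
  shows "h 0 = 0" "h 1 = 1" "h (a + b) = h a + h b" "h (a * b) = h a * h b"
  using assms by (auto simp: rhom_def)

lemma rhom_const3: "rhom const3"
  by (auto simp: rhom_def const3_def one_pCons)

lemma eval1_0 [simp]: "eval1 h u 0 = 0"
  by (simp add: eval1_def)

lemma eval1_pCons:
  assumes "rhom h" shows "eval1 h u (pCons a p) = h a + u * eval1 h u p"
  using rhomD[OF assms] by (simp add: eval1_def map_poly_pCons)

lemma eval1_add:
  assumes "rhom h" shows "eval1 h u (p + q) = eval1 h u p + eval1 h u q"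
proof -
  have "map_poly h (p + q) = map_poly h p + map_poly h q"
    by (rule poly_eqI) (simp add: coeff_map_poly rhomD[OF assms])
  then show ?thesis by (simp add: eval1_def)
qed

lemma eval1_smult:
  assumes "rhom h" shows "eval1 h u (smult c p) = h c * eval1 h u p"
  using rhomD[OF assms] by (simp add: eval1_def map_poly_smult)

lemma eval1_mult:
  assumes "rhom h" shows "eval1 h u (p * q) = eval1 h u p * eval1 h u q"
proof (induction p)
  case (pCons a p)
  then show ?case
    by (simp add: eval1_pCons[OF assms] eval1_add[OF assms] eval1_smult[OF assms] rhomD[OF assms]
        algebra_simps)
qed simp

lemma rhom_eval1:
  assumes "rhom h" shows "rhom (eval1 h u)"
  unfolding rhom_def
  using eval1_add[OF assms] eval1_mult[OF assms] eval1_pCons[OF assms, of u 1 0] rhomD[OF assms]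
  by (simp add: one_pCons)

lemma rhom_eval3:
  assumes "rhom h" shows "rhom (eval3 h t)"
proof -
  obtain u v w where "t = (u, v, w)" by (cases t)
  then have "eval3 h t = eval1 (eval1 (eval1 h w) v) u" by auto
  then show ?thesis using assms by (simp add: rhom_eval1)
qed

lemma eval3_const3: "rhom h \<Longrightarrow> eval3 h t (const3 c) = h c"
  by (cases t) (simp add: const3_def eval1_pCons rhom_eval1)

lemma eval3_vars:
  assumes "rhom h"
  shows "eval3 h (u, v, w) varX = u" "eval3 h (u, v, w) varY = v" "eval3 h (u, v, w) varZ = w"
  using rhomD[OF assms] rhomD[OF rhom_eval1[OF assms]] rhomD[OF rhom_eval1[OF rhom_eval1[OF assms]]]
  by (simp_all add: varX_def varY_def varZ_def eval1_pCons rhom_eval1 assms)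

lemma rhom_poly3_eqI:
  fixes f g :: "poly3 \<Rightarrow> 'b::comm_ring_1"
  assumes f: "rhom f" and g: "rhom g"
    and c: "\<And>c. f (const3 c) = g (const3 c)"
    and "f varX = g varX" "f varY = g varY" "f varZ = g varZ"
  shows "f P = g P"
proof -
  have 1: "f [:[:r:]:] = g [:[:r:]:]" for r
  proof (induction r)
    case 0
    then show ?case using rhomD[OF f] rhomD[OF g] by simp
  next
    case (pCons a r)
    have "[:[:pCons a r:]:] = const3 a + varZ * [:[:r:]:]"
      by (simp add: const3_def varZ_def)
    then show ?case using pCons assms rhomD[OF f] rhomD[OF g] by metis
  qed
  have 2: "f [:q:] = g [:q:]" for q
  proof (induction q)
    case 0
    then show ?case using rhomD[OF f] rhomD[OF g] by simp
  next
    case (pCons a q)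
    have "[:pCons a q:] = [:[:a:]:] + varY * [:q:]"
      by (simp add: varY_def)
    then show ?case using pCons 1 assms rhomD[OF f] rhomD[OF g] by metis
  qed
  show ?thesis
  proof (induction P)
    case 0
    then show ?case using rhomD[OF f] rhomD[OF g] by simp
  next
    case (pCons a q)
    have "pCons a q = [:a:] + varX * q"
      by (simp add: varX_def)
    then show ?case using pCons 2 assms rhomD[OF f] rhomD[OF g] by metis
  qed
qed

lemma eval1_altdef:
  assumes "h 0 = 0"
  shows "eval1 h u p = (\<Sum>i\<le>degree p. h (coeff p i) * u ^ i)"
proof -
  have c: "coeff (map_poly h p) i = h (coeff p i)" for i
    by (simp add: coeff_map_poly assms)
  have "degree (map_poly h p) \<le> degree p"
    by (rule degree_le) (simp add: c coeff_eq_0 assms)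
  then have "(\<Sum>i\<le>degree (map_poly h p). h (coeff p i) * u ^ i)
      = (\<Sum>i\<le>degree p. h (coeff p i) * u ^ i)"
    by (intro sum.mono_neutral_left) (auto simp: c[symmetric] coeff_eq_0)
  then show ?thesis by (simp add: eval1_def poly_altdef c)
qed

lemma eval3_sum:
  assumes h: "rhom h"
  shows "eval3 h (u, v, w) P = (\<Sum>i\<le>degree P. \<Sum>j\<le>degree (coeff P i).
    \<Sum>k\<le>degree (coeff (coeff P i) j). h (coeff (coeff (coeff P i) j) k) * w ^ k * v ^ j * u ^ i)"
  by (simp add: eval1_altdef rhomD(1)[OF h] sum_distrib_right)

declare eval3.simps [simp del]

lemma homogeneous_0 [simp]: "homogeneous d 0"
  by (simp add: homogeneous_def)

lemma homogeneous_const3: "homogeneous 0 (const3 c)"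
  by (auto simp: homogeneous_def const3_def coeff_pCons split: nat.splits)

lemma homogeneous_1: "homogeneous 0 1"
  using homogeneous_const3[of 1] rhomD(2)[OF rhom_const3] by simp

lemma homogeneous_vars: "homogeneous 1 varX" "homogeneous 1 varY" "homogeneous 1 varZ"
  by (auto simp: homogeneous_def varX_def varY_def varZ_def coeff_pCons one_pCons split: nat.splits)

lemma homogeneous_add: "homogeneous d P \<Longrightarrow> homogeneous d Q \<Longrightarrow> homogeneous d (P + Q)"
  unfolding homogeneous_def by (metis add_0_right coeff_add)

lemma homogeneous_sum: "(\<And>i. i \<in> A \<Longrightarrow> homogeneous d (f i)) \<Longrightarrow> homogeneous d (sum f A)"
  by (induction A rule: infinite_finite_induct) (auto intro: homogeneous_add)

lemma homogeneous_mult: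
  assumes "homogeneous d P" "homogeneous e Q" shows "homogeneous (d + e) (P * Q)"
  unfolding homogeneous_def
proof (intro allI impI)
  fix i j k assume nz: "coeff (coeff (coeff (P * Q) i) j) k \<noteq> 0"
  let ?p = "\<lambda>i j k. coeff (coeff (coeff P i) j) k" and ?q = "\<lambda>i j k. coeff (coeff (coeff Q i) j) k"
  have "coeff (coeff (coeff (P * Q) i) j) k =
      (\<Sum>a\<le>i. \<Sum>b\<le>j. \<Sum>c\<le>k. ?p a b c * ?q (i - a) (j - b) (k - c))"
    by (simp add: coeff_mult coeff_sum)
  with nz obtain a b c where "a \<le> i" "b \<le> j" "c \<le> k" "?p a b c * ?q (i - a) (j - b) (k - c) \<noteq> 0"
    by (metis (no_types, lifting) atMost_iff sum.not_neutral_contains_not_neutral)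
  moreover from this have "a + b + c = d" "(i - a) + (j - b) + (k - c) = e"
    using assms unfolding homogeneous_def by (metis mult_zero_left mult_zero_right)+
  ultimately show "i + j + k = d + e" by linarith
qed

lemma homogeneous_power: "homogeneous e P \<Longrightarrow> homogeneous (n * e) (P ^ n)"
  by (induction n) (auto intro: homogeneous_mult homogeneous_1)

lemma eval3_scale:
  assumes h: "rhom h" and P: "homogeneous d P"
  shows "eval3 h (s * u, s * v, s * w) P = s ^ d * eval3 h (u, v, w) P"
  unfolding eval3_sum[OF h] sum_distrib_left
proof (intro sum.cong refl, goal_cases)
  case (1 i j k)
  show ?case
  proof (cases "coeff (coeff (coeff P i) j) k = 0")
    case True
    then show ?thesis by (simp add: rhomD(1)[OF h])
  next
    case False
    then have "d = i + j + k" using P by (simp add: homogeneous_def)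
    then show ?thesis by (simp add: power_mult_distrib power_add algebra_simps)
  qed
qed

lemma homogeneous_eval3:
  assumes "homogeneous d P" "homogeneous e U" "homogeneous e V" "homogeneous e W"
  shows "homogeneous (d * e) (eval3 const3 (U, V, W) P)"
  unfolding eval3_sum[OF rhom_const3]
proof (intro homogeneous_sum)
  fix i j k
  show "homogeneous (d * e) (const3 (coeff (coeff (coeff P i) j) k) * W ^ k * V ^ j * U ^ i)"
  proof (cases "coeff (coeff (coeff P i) j) k = 0")
    case True
    then show ?thesis by (simp add: rhomD(1)[OF rhom_const3])
  next
    case False
    then have "i + j + k = d" using assms(1) by (simp add: homogeneous_def)
    then have "d * e = 0 + k * e + j * e + i * e" by (auto simp: algebra_simps)
    then show ?thesis
      by (metis homogeneous_mult homogeneous_power homogeneous_const3 assms(2-4))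
  qed
qed


section \<open>Rational maps and birational maps of the projective plane\<close>

text \<open>
  A rational self-map of the complex projective plane is represented by a triple of homogeneous
  polynomials of the same degree, not all zero; two triples represent the same map iff they are
  proportional.
\<close>

type_synonym triple = "poly3 \<times> poly3 \<times> poly3"

fun rational_triple :: "triple \<Rightarrow> bool" where
  "rational_triple (P, Q, R) \<longleftrightarrow> (P, Q, R) \<noteq> (0, 0, 0) \<and>
     (\<exists>d. homogeneous d P \<and> homogeneous d Q \<and> homogeneous d R)"

text \<open>The nonvanishing is part of the relation because a composite of triples may vanish identically.\<close>

fun same_map :: "triple \<Rightarrow> triple \<Rightarrow> bool" where
  "same_map (P, Q, R) (P', Q', R') \<longleftrightarrow>
     (P, Q, R) \<noteq> (0, 0, 0) \<and> (P', Q', R') \<noteq> (0, 0, 0) \<and>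
     P * Q' = P' * Q \<and> P * R' = P' * R \<and> Q * R' = Q' * R"

fun comp_triple :: "triple \<Rightarrow> triple \<Rightarrow> triple" where
  "comp_triple (P, Q, R) G = (eval3 const3 G P, eval3 const3 G Q, eval3 const3 G R)"

definition id_triple :: triple where
  "id_triple = (varX, varY, varZ)"

definition birational_triple :: "triple \<Rightarrow> bool" where
  "birational_triple F \<longleftrightarrow> rational_triple F \<and>
     (\<exists>G. rational_triple G \<and> same_map (comp_triple F G) id_triple \<and>
          same_map (comp_triple G F) id_triple)"

fun scale :: "poly3 \<Rightarrow> triple \<Rightarrow> triple" where
  "scale a (P, Q, R) = (a * P, a * Q, a * R)"

lemma scale_0_iff: "a \<noteq> 0 \<Longrightarrow> scale a F = (0, 0, 0) \<longleftrightarrow> F = (0, 0, 0)"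
  by (cases F) auto

lemma same_map_scaleI:
  assumes "scale a F = scale b G" "a \<noteq> 0" "b \<noteq> 0" "F \<noteq> (0, 0, 0)"
  shows "same_map F G"
proof -
  obtain P Q R P' Q' R' where F: "F = (P, Q, R)" and G: "G = (P', Q', R')"
    by (cases F, cases G)
  have e: "a * P = b * P'" "a * Q = b * Q'" "a * R = b * R'"
    using assms(1) by (auto simp: F G)
  have "G \<noteq> (0, 0, 0)" using assms scale_0_iff by metis
  have *: "x * y' = x' * y" if "a * x = b * x'" "a * y = b * y'" for x y x' y'
  proof -
    have "b * (x * y') = x * (b * y')" by (simp add: algebra_simps)
    also have "\<dots> = (a * x) * y" by (simp add: that(2)[symmetric] algebra_simps)
    also have "\<dots> = b * (x' * y)" by (simp add: that(1) algebra_simps)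
    finally show ?thesis using assms(3) by (metis mult_cancel_left)
  qed
  show ?thesis
    using assms(4) \<open>G \<noteq> _\<close> *[OF e(1,2)] *[OF e(1,3)] *[OF e(2,3)] by (simp add: F G)
qed

lemma same_map_nz: "same_map F G \<Longrightarrow> F \<noteq> (0, 0, 0)" "same_map F G \<Longrightarrow> G \<noteq> (0, 0, 0)"
  by (cases F; cases G; simp)+

lemma same_map_refl: "F \<noteq> (0, 0, 0) \<Longrightarrow> same_map F F"
  by (rule same_map_scaleI[of 1 _ 1]) auto

lemma same_map_sym: "same_map F G \<Longrightarrow> same_map G F"
  by (cases F; cases G) (auto simp: algebra_simps)

fun components :: "triple \<Rightarrow> poly3 set" where
  "components (P, Q, R) = {P, Q, R}"

lemma same_map_scaleE:
  assumes "same_map F G"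
  obtains a b where "scale a F = scale b G" "a \<noteq> 0" "b \<noteq> 0" "a \<in> components G" "b \<in> components F"
proof -
  obtain P Q R P' Q' R' where F: "F = (P, Q, R)" and G: "G = (P', Q', R')"
    by (cases F, cases G)
  have e: "P * Q' = P' * Q" "P * R' = P' * R" "Q * R' = Q' * R"
    using assms by (auto simp: F G)
  have nz: "P \<noteq> 0 \<or> Q \<noteq> 0 \<or> R \<noteq> 0" "P' \<noteq> 0 \<or> Q' \<noteq> 0 \<or> R' \<noteq> 0"
    using assms by (auto simp: F G)
  have "P \<noteq> 0 \<and> P' \<noteq> 0 \<or> Q \<noteq> 0 \<and> Q' \<noteq> 0 \<or> R \<noteq> 0 \<and> R' \<noteq> 0"
    using nz e by (cases "P = 0"; cases "Q = 0"; cases "P' = 0"; cases "Q' = 0") auto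
  then consider "P \<noteq> 0" "P' \<noteq> 0" | "Q \<noteq> 0" "Q' \<noteq> 0" | "R \<noteq> 0" "R' \<noteq> 0" by blast
  then show ?thesis
  proof cases
    case 1 show ?thesis by (rule that[of P' P]) (use e 1 in \<open>auto simp: F G algebra_simps\<close>)
  next
    case 2 show ?thesis by (rule that[of Q' Q]) (use e 2 in \<open>auto simp: F G algebra_simps\<close>)
  next
    case 3 show ?thesis by (rule that[of R' R]) (use e 3 in \<open>auto simp: F G algebra_simps\<close>)
  qed
qed

lemma scale_scale: "scale a (scale b F) = scale (a * b) F"
  by (cases F) (simp add: algebra_simps)

lemma same_map_trans:
  assumes "same_map F G" "same_map G H" shows "same_map F H"
proof -
  obtain a b where 1: "scale a F = scale b G" "a \<noteq> 0" "b \<noteq> 0"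
    using same_map_scaleE[OF assms(1)] by metis
  obtain c d where 2: "scale c G = scale d H" "c \<noteq> 0" "d \<noteq> 0"
    using same_map_scaleE[OF assms(2)] by metis
  have "scale (c * a) F = scale c (scale b G)" by (metis 1(1) scale_scale)
  also have "\<dots> = scale b (scale c G)" by (simp add: scale_scale mult.commute)
  also have "\<dots> = scale (b * d) H" by (simp add: 2 scale_scale)
  finally show ?thesis
    by (rule same_map_scaleI) (use 1 2 same_map_nz[OF assms(1)] in auto)
qed

lemma rational_triple_iff:
  "rational_triple F \<longleftrightarrow> F \<noteq> (0, 0, 0) \<and> (\<exists>d. \<forall>P\<in>components F. homogeneous d P)"
  by (cases F) auto

lemma eval3_comp:
  assumes "rhom h"
  shows "eval3 h (u, v, w) (eval3 const3 (U, V, W) P) =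
    eval3 h (eval3 h (u, v, w) U, eval3 h (u, v, w) V, eval3 h (u, v, w) W) P"
proof -
  note * = rhomD[OF rhom_eval3[OF rhom_const3]] rhomD[OF rhom_eval3[OF assms]]
  have "rhom (\<lambda>P. eval3 h (u, v, w) (eval3 const3 (U, V, W) P))"
    by (simp add: rhom_def[of "\<lambda>P. _ P"] *)
  then show ?thesis
    by (rule rhom_poly3_eqI[OF _ rhom_eval3[OF assms]])
      (simp_all add: eval3_const3 eval3_vars rhom_const3 assms)
qed

lemma eval3_comp_triple:
  "eval3 const3 (comp_triple G H) P = eval3 const3 H (eval3 const3 G P)"
  by (cases G; cases H) (simp add: eval3_comp rhom_const3)

lemma comp_triple_assoc:
  "comp_triple (comp_triple F G) H = comp_triple F (comp_triple G H)"
  by (cases F) (simp add: eval3_comp_triple)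

lemma comp_id_left: "comp_triple id_triple F = F"
  by (cases F) (simp add: id_triple_def eval3_vars rhom_const3)

lemma eval3_id: "eval3 const3 id_triple P = P"
  unfolding id_triple_def
  by (rule rhom_poly3_eqI[where g = "\<lambda>P. P"])
    (simp_all add: rhom_eval3 rhom_const3 eval3_const3 eval3_vars rhom_def[of "\<lambda>P. P"])

lemma comp_id_right: "comp_triple F id_triple = F"
  by (cases F) (simp add: eval3_id)

lemma eval3_scale_triple:
  assumes "homogeneous d P"
  shows "eval3 const3 (scale s G) P = s ^ d * eval3 const3 G P"
  by (cases G) (simp add: eval3_scale[OF rhom_const3 assms])

lemma comp_scale_right:
  assumes "\<forall>P\<in>components F. homogeneous d P"
  shows "comp_triple F (scale s G) = scale (s ^ d) (comp_triple F G)"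
  using assms by (cases F) (simp add: eval3_scale_triple)

lemma comp_scale_left: "comp_triple (scale a F) G = scale (eval3 const3 G a) (comp_triple F G)"
  by (cases F) (simp add: rhomD[OF rhom_eval3[OF rhom_const3]])

definition dominant_triple :: "triple \<Rightarrow> bool" where
  "dominant_triple G \<longleftrightarrow> (\<forall>d P. homogeneous d P \<longrightarrow> P \<noteq> 0 \<longrightarrow> eval3 const3 G P \<noteq> 0)"

lemma comp_nz:
  assumes "rational_triple F" "dominant_triple G"
  shows "comp_triple F G \<noteq> (0, 0, 0)"
  using assms by (cases F) (auto simp: dominant_triple_def)

lemma rational_comp:
  assumes "rational_triple F" "rational_triple G" "dominant_triple G"
  shows "rational_triple (comp_triple F G)"
proof -
  obtain d e where d: "\<forall>P\<in>components F. homogeneous d P" and e: "\<forall>P\<in>components G. homogeneous e P"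
    using assms unfolding rational_triple_iff by blast
  have "\<forall>P\<in>components (comp_triple F G). homogeneous (d * e) P"
    using d e by (cases F; cases G) (auto simp: homogeneous_eval3)
  then show ?thesis using comp_nz[OF assms(1,3)] unfolding rational_triple_iff by blast
qed

lemma dominant_comp:
  assumes "dominant_triple F" "rational_triple F" "dominant_triple G"
  shows "dominant_triple (comp_triple F G)"
  unfolding dominant_triple_def
proof (intro allI impI)
  fix d P assume P: "homogeneous d P" "P \<noteq> 0"
  obtain e where e: "\<forall>P\<in>components F. homogeneous e P"
    using assms unfolding rational_triple_iff by blast
  have "homogeneous (d * e) (eval3 const3 F P)"
    using P e by (cases F) (auto simp: homogeneous_eval3)
  moreover have "eval3 const3 F P \<noteq> 0" using assms(1) P by (auto simp: dominant_triple_def)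
  ultimately show "eval3 const3 (comp_triple F G) P \<noteq> 0"
    using assms(3) unfolding eval3_comp_triple dominant_triple_def by blast
qed

lemma same_map_comp_left:
  assumes "same_map F F'" "rational_triple F" "rational_triple F'" "dominant_triple G"
  shows "same_map (comp_triple F G) (comp_triple F' G)"
proof -
  obtain a b where ab: "scale a F = scale b F'" "a \<noteq> 0" "b \<noteq> 0"
    "a \<in> components F'" "b \<in> components F"
    using same_map_scaleE[OF assms(1)] .
  have "eval3 const3 G a \<noteq> 0" "eval3 const3 G b \<noteq> 0"
    using ab assms unfolding rational_triple_iff dominant_triple_def by blast+
  moreover have "scale (eval3 const3 G a) (comp_triple F G) = scale (eval3 const3 G b) (comp_triple F' G)"
    using ab by (simp add: comp_scale_left[symmetric])
  ultimately show ?thesis using same_map_scaleI comp_nz assms by metis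
qed

lemma same_map_comp_right:
  assumes "same_map G G'" "rational_triple F" "comp_triple F G \<noteq> (0, 0, 0)"
  shows "same_map (comp_triple F G) (comp_triple F G')"
proof -
  obtain a b where ab: "scale a G = scale b G'" "a \<noteq> 0" "b \<noteq> 0"
    using same_map_scaleE[OF assms(1)] .
  obtain d where d: "\<forall>P\<in>components F. homogeneous d P"
    using assms unfolding rational_triple_iff by blast
  have "scale (a ^ d) (comp_triple F G) = scale (b ^ d) (comp_triple F G')"
    using ab by (simp add: comp_scale_right[OF d, symmetric])
  then show ?thesis using same_map_scaleI ab assms by (metis power_not_zero)
qed

lemma dominantI:
  assumes "same_map (comp_triple G H) id_triple"
  shows "dominant_triple G"
  unfolding dominant_triple_def
proof (intro allI impI)
  fix d P assume P: "homogeneous d P" "P \<noteq> 0"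
  obtain a b where ab: "scale a (comp_triple G H) = scale b id_triple" "a \<noteq> 0" "b \<noteq> 0"
    using same_map_scaleE[OF assms] .
  have "a ^ d * eval3 const3 H (eval3 const3 G P) = eval3 const3 (scale a (comp_triple G H)) P"
    by (simp add: eval3_scale_triple[OF P(1)] eval3_comp_triple)
  also have "\<dots> = b ^ d * P" by (simp add: ab eval3_scale_triple[OF P(1)] eval3_id)
  finally have "eval3 const3 H (eval3 const3 G P) \<noteq> 0" using P ab by auto
  then show "eval3 const3 G P \<noteq> 0" using rhomD(1)[OF rhom_eval3[OF rhom_const3]] by metis
qed

lemma birational_rational: "birational_triple F \<Longrightarrow> rational_triple F"
  by (simp add: birational_triple_def)

lemma birational_dominant: "birational_triple F \<Longrightarrow> dominant_triple F"
  unfolding birational_triple_def using dominantI by blast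

lemma birational_inverse:
  assumes "birational_triple F"
  obtains G where "birational_triple G" "same_map (comp_triple F G) id_triple"
    "same_map (comp_triple G F) id_triple"
  using assms unfolding birational_triple_def by blast

lemma rational_id: "rational_triple id_triple"
proof -
  have "varX \<noteq> 0" by (simp add: varX_def)
  then show ?thesis unfolding id_triple_def using homogeneous_vars by auto
qed

lemma inverse_comp_aux:
  assumes "birational_triple F" "birational_triple G" "birational_triple F'" "birational_triple G'"
    and "same_map (comp_triple F F') id_triple" "same_map (comp_triple G G') id_triple"
  shows "same_map (comp_triple (comp_triple F G) (comp_triple G' F')) id_triple"
proof -
  note r = assms(1-4)[THEN birational_rational] and d = assms(1-4)[THEN birational_dominant]
  have id: "rational_triple id_triple"
    by (rule rational_id)
  have 1: "same_map (comp_triple (comp_triple G G') F') F'"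
    using same_map_comp_left[OF assms(6) rational_comp[OF r(2,4) d(4)] id d(3)]
    by (simp add: comp_id_left)
  have "comp_triple F (comp_triple (comp_triple G G') F') \<noteq> (0, 0, 0)"
    by (intro comp_nz dominant_comp rational_comp r d)
  from same_map_trans[OF same_map_comp_right[OF 1 r(1) this] assms(5)]
  show ?thesis by (simp add: comp_triple_assoc)
qed

lemma birational_comp:
  assumes "birational_triple F" "birational_triple G"
  shows "birational_triple (comp_triple F G)"
proof -
  obtain F' where F': "birational_triple F'" "same_map (comp_triple F F') id_triple"
    "same_map (comp_triple F' F) id_triple"
    using birational_inverse[OF assms(1)] .
  obtain G' where G': "birational_triple G'" "same_map (comp_triple G G') id_triple"
    "same_map (comp_triple G' G) id_triple"
    using birational_inverse[OF assms(2)] .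
  show ?thesis
    unfolding birational_triple_def
    using inverse_comp_aux[OF assms F'(1) G'(1) F'(2) G'(2)]
      inverse_comp_aux[OF G'(1) F'(1) assms(2) assms(1) G'(3) F'(3)]
      rational_comp assms F' G' birational_rational birational_dominant
    by metis
qed

lemma birational_id: "birational_triple id_triple"
proof -
  have "rational_triple id_triple"
    by (rule rational_id)
  moreover have "same_map id_triple id_triple"
    by (rule same_map_refl) (auto simp: id_triple_def varX_def)
  ultimately show ?thesis unfolding birational_triple_def by (metis comp_id_left)
qed

lemma same_map_comp:
  assumes "birational_triple F" "birational_triple F'" "same_map F F'"
    "birational_triple G" "birational_triple G'" "same_map G G'"
  shows "same_map (comp_triple F G) (comp_triple F' G')"
  using same_map_trans[OF same_map_comp_left same_map_comp_right] comp_nz assms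
    birational_rational birational_dominant by metis

quotient_type bir_P2 = triple / partial:
  "\<lambda>F G. birational_triple F \<and> birational_triple G \<and> same_map F G"
  morphisms rep_bir_P2 abs_bir_P2
proof (rule part_equivpI)
  show "\<exists>F. birational_triple F \<and> birational_triple F \<and> same_map F F"
    using birational_id same_map_refl birational_rational rational_triple_iff by blast
qed (auto intro!: sympI transpI intro: same_map_sym same_map_trans)

instantiation bir_P2 :: monoid_mult
begin

lift_definition one_bir_P2 :: bir_P2 is id_triple
  using birational_id same_map_refl birational_rational rational_triple_iff by blast

lift_definition times_bir_P2 :: "bir_P2 \<Rightarrow> bir_P2 \<Rightarrow> bir_P2" is comp_triple
  using birational_comp same_map_comp by blast

instance
proof
  fix a b c :: bir_P2
  have *: "same_map F F" if "birational_triple F" for F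
    using that same_map_refl birational_rational rational_triple_iff by blast
  show "a * b * c = a * (b * c)"
    by transfer (use birational_comp * in \<open>simp add: comp_triple_assoc\<close>)
  show "1 * a = a" by transfer (simp add: comp_id_left)
  show "a * 1 = a" by transfer (simp add: comp_id_right)
qed

end

lemma bir_P2_inverse: "\<exists>\<psi>. \<phi> * \<psi> = 1 \<and> \<psi> * \<phi> = (1 :: bir_P2)"
proof transfer
  fix F assume "birational_triple F \<and> birational_triple F \<and> same_map F F"
  then show "\<exists>G\<in>Collect (\<lambda>F. birational_triple F \<and> birational_triple F \<and> same_map F F). 
      (birational_triple (comp_triple F G) \<and> birational_triple id_triple \<and>
        same_map (comp_triple F G) id_triple) \<and>
      (birational_triple (comp_triple G F) \<and> birational_triple id_triple \<and>
        same_map (comp_triple G F) id_triple)"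
    using birational_inverse birational_comp birational_id same_map_refl birational_rational
      rational_triple_iff mem_Collect_eq by (metis (no_types, lifting))
qed


section \<open>The affine chart and the de Jonquieres group\<close>

text \<open>The function field \<open>\<complex>(x, y)\<close>, rendered as \<open>\<complex>(y)(x)\<close>.\<close>

type_synonym ratfun_y = "complex poly fract"
type_synonym ratfun_xy = "complex poly fract poly fract"

definition const_y :: "complex \<Rightarrow> ratfun_y" where
  "const_y c = to_fract [:c:]"

definition of_ratfun_y :: "ratfun_y \<Rightarrow> ratfun_xy" where
  "of_ratfun_y A = to_fract [:A:]"

definition const_xy :: "complex \<Rightarrow> ratfun_xy" where
  "const_xy c = of_ratfun_y (const_y c)"

definition coord_x :: ratfun_xy where
  "coord_x = to_fract [:0, 1:]"

definition coord_y :: ratfun_xy where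
  "coord_y = of_ratfun_y (to_fract [:0, 1:])"

definition dehomogenize :: "poly3 \<Rightarrow> ratfun_xy" where
  "dehomogenize P = eval3 const_xy (coord_x, coord_y, 1) P"

lemma rhom_const_xy: "rhom const_xy"
proof -
  have *: "to_fract [:a + b:] = to_fract [:a:] + to_fract [:b:]"
    "to_fract [:a * b:] = to_fract [:a:] * to_fract [:b:]" for a b :: "'a::idom"
    by (simp_all flip: to_fract_add to_fract_mult)
  show ?thesis
    unfolding rhom_def const_xy_def of_ratfun_y_def const_y_def * by (simp flip: one_pCons)
qed

lemma dehomogenize_altdef:
  "dehomogenize P =
     to_fract (map_poly (\<lambda>q. to_fract (map_poly (\<lambda>r. poly r 1) q)) P)"
proof -
  have 1: "eval1 const_xy 1 r = const_xy (poly r 1)" for r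
    by (induction r) (simp_all add: eval1_pCons rhom_const_xy rhomD[OF rhom_const_xy])
  have 2: "eval1 (eval1 const_xy 1) coord_y q = of_ratfun_y (to_fract (map_poly (\<lambda>r. poly r 1) q))" for q
  proof (induction q)
    case 0
    then show ?case by (simp add: of_ratfun_y_def)
  next
    case (pCons a q)
    have "pCons (poly a 1) (map_poly (\<lambda>r. poly r 1) q)
        = [:poly a 1:] + [:0, 1:] * map_poly (\<lambda>r. poly r 1) q" by simp
    then have "of_ratfun_y (to_fract (pCons (poly a 1) (map_poly (\<lambda>r. poly r 1) q)))
        = const_xy (poly a 1) + coord_y * of_ratfun_y (to_fract (map_poly (\<lambda>r. poly r 1) q))"
      unfolding const_xy_def const_y_def coord_y_def of_ratfun_y_def
      by (simp add: flip: to_fract_mult to_fract_add)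
    then show ?case
      using pCons(1)
      unfolding eval1_pCons[OF rhom_eval1[OF rhom_const_xy]] pCons.IH
      unfolding 1 by (simp add: map_poly_pCons)
  qed
  have 3: "eval1 (eval1 (eval1 const_xy 1) coord_y) coord_x P =
      to_fract (map_poly (\<lambda>q. to_fract (map_poly (\<lambda>r. poly r 1) q)) P)" for P
  proof (induction P)
    case (pCons a q)
    let ?f = "\<lambda>q. to_fract (map_poly (\<lambda>r. poly r 1) q)"
    have "pCons (?f a) (map_poly ?f q) = [:?f a:] + [:0, 1:] * map_poly ?f q" by simp
    then have "to_fract (pCons (?f a) (map_poly ?f q))
        = of_ratfun_y (?f a) + coord_x * to_fract (map_poly ?f q)"
      unfolding coord_x_def of_ratfun_y_def by (simp flip: to_fract_mult to_fract_add)
    then show ?case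
      using pCons(1)
      unfolding eval1_pCons[OF rhom_eval1[OF rhom_eval1[OF rhom_const_xy]]] pCons.IH
      unfolding 2 by (simp add: map_poly_pCons)
  qed simp
  show ?thesis unfolding dehomogenize_def by (simp add: eval3.simps 3)
qed

lemma dehomogenize_eq_0:
  assumes P: "homogeneous d P" and "dehomogenize P = 0"
  shows "P = 0"
proof -
  have "map_poly (\<lambda>q. to_fract (map_poly (\<lambda>r. poly r 1) q)) P = 0"
    using assms(2) unfolding dehomogenize_altdef by simp
  then have "map_poly (\<lambda>r. poly r 1) (coeff P i) = 0" for i
    by (metis (mono_tags, lifting) coeff_0 coeff_map_poly map_poly_0 to_fract_eq_0_iff)
  then have *: "poly (coeff (coeff P i) j) 1 = 0" for i j
    by (metis (mono_tags, lifting) coeff_0 coeff_map_poly poly_0)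
  have "coeff (coeff (coeff P i) j) k = 0" for i j k
  proof (rule ccontr)
    assume nz: "coeff (coeff (coeff P i) j) k \<noteq> 0"
    let ?r = "coeff (coeff P i) j"
    have "coeff ?r l = 0" if "l \<noteq> k" for l
      using that P nz unfolding homogeneous_def by (metis add_left_cancel)
    then have "?r = monom (coeff ?r k) k" by (intro poly_eqI) auto
    then have "poly ?r 1 = coeff ?r k" by (metis mult.right_neutral poly_monom power_one)
    with * nz show False by simp
  qed
  then show ?thesis by (simp add: poly_eq_iff)
qed

text \<open>
  The expression of a birational map in the affine chart \<open>(x, y) \<mapsto> [x : y : 1]\<close>. The last
  component of a birational triple is never zero, so neither is the denominator here.
\<close>

fun affine_triple :: "triple \<Rightarrow> ratfun_xy \<times> ratfun_xy" where
  "affine_triple (P, Q, R) = (dehomogenize P / dehomogenize R, dehomogenize Q / dehomogenize R)"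

lemma birational_last_nz: "birational_triple (P, Q, R) \<Longrightarrow> R \<noteq> 0"
  using birational_dominant[of "(P, Q, R)"] homogeneous_vars(3)
  unfolding dominant_triple_def
  by (metis eval3_vars(3) rhom_const3 varZ_def pCons_eq_0_iff one_neq_zero)

lift_definition affine_form :: "bir_P2 \<Rightarrow> ratfun_xy \<times> ratfun_xy" is affine_triple
proof -
  fix F G assume *: "birational_triple F \<and> birational_triple G \<and> same_map F G"
  obtain P Q R P' Q' R' where F: "F = (P, Q, R)" and G: "G = (P', Q', R')"
    by (cases F, cases G)
  have "R \<noteq> 0" "R' \<noteq> 0" using * birational_last_nz F G by auto
  moreover have "\<exists>d. homogeneous d R" "\<exists>d. homogeneous d R'"
    using * birational_rational F G by (metis rational_triple.simps)+
  ultimately have nz: "dehomogenize R \<noteq> 0" "dehomogenize R' \<noteq> 0"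
    using dehomogenize_eq_0 by blast+
  have m: "dehomogenize (A * B) = dehomogenize A * dehomogenize B" for A B
    unfolding dehomogenize_def using rhomD[OF rhom_eval3[OF rhom_const_xy]] by blast
  have "P * R' = P' * R" "Q * R' = Q' * R" using * F G by auto
  then have "dehomogenize P * dehomogenize R' = dehomogenize P' * dehomogenize R"
    "dehomogenize Q * dehomogenize R' = dehomogenize Q' * dehomogenize R"
    by (metis m)+
  then show "affine_triple F = affine_triple G"
    using nz by (simp add: F G frac_eq_eq)
qed

text \<open>
  For an invertible matrix the denominators in the next two definitions are nonzero in
  \<open>\<complex>(x, y)\<close>, so the convention \<open>u / 0 = 0\<close> plays no role in the definitions of the groups below.
\<close>

definition moebius_x :: "ratfun_y \<Rightarrow> ratfun_y \<Rightarrow> ratfun_y \<Rightarrow> ratfun_y \<Rightarrow> ratfun_xy" where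
  "moebius_x A B C D =
     (of_ratfun_y A * coord_x + of_ratfun_y B) / (of_ratfun_y C * coord_x + of_ratfun_y D)"

definition moebius_y :: "complex \<Rightarrow> complex \<Rightarrow> complex \<Rightarrow> complex \<Rightarrow> ratfun_xy" where
  "moebius_y a b c d =
     (const_xy a * coord_y + const_xy b) / (const_xy c * coord_y + const_xy d)"

text \<open>
  Elements of \<open>PGL\<^sub>2\<close> are represented by matrices of nonzero determinant; the Moebius
  transformation only depends on the class.
\<close>

definition de_Jonquieres :: "bir_P2 set" where
  "de_Jonquieres = {\<phi>. \<exists>A B C D a b c d.
     A * D - B * C \<noteq> 0 \<and> a * d - b * c \<noteq> 0 \<and>
     affine_form \<phi> = (moebius_x A B C D, moebius_y a b c d)}"

definition de_Jonquieres0 :: "bir_P2 set" where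
  "de_Jonquieres0 = {\<phi>. \<exists>A B C D. A * D - B * C \<noteq> 0 \<and> affine_form \<phi> = (moebius_x A B C D, coord_y)}"

definition centralizer :: "bir_P2 \<Rightarrow> bir_P2 set" where
  "centralizer \<phi> = {\<psi>. \<psi> * \<phi> = \<phi> * \<psi>}"

definition periodic :: "bir_P2 \<Rightarrow> bool" where
  "periodic \<phi> \<longleftrightarrow> (\<exists>n>0. \<phi> ^ n = 1)"

end

theory Submission
  imports Defs
begin

text \<open>
  A birational map \<open>\<psi>\<close> acts on the function field \<open>K = \<complex>(x, y)\<close> by the pullback
  \<open>\<psi>\<^sup>* u = u \<circ> \<psi>\<close>, a field automorphism over \<open>\<complex>\<close>; composites pull back in reverse order. For
  \<open>\<phi> \<in> J\<^sub>0\<close> the pullback fixes \<open>y\<close>, hence the subfield \<open>\<complex>(y)\<close>.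

  Suppose that \<open>\<phi>\<close> has infinite order. Then \<open>\<complex>(y)\<close> is all that \<open>\<phi>\<^sup>*\<close> fixes: if
  \<open>u = p(x) / q(x)\<close> were a fixed element outside \<open>\<complex>(y)\<close>, then \<open>p(T) - u q(T)\<close> would be a nonzero
  polynomial with \<open>\<phi>\<^sup>*\<close>-invariant coefficients and the root \<open>x\<close>, so all the functions
  \<open>(\<phi>\<^sup>k)\<^sup>* x\<close> would be among its finitely many roots; two of them would
  coincide, and some positive power of \<open>\<phi>\<close> would be the identity (\<open>invariant_function_in_base\<close>).

  If \<open>\<psi>\<close> commutes with \<open>\<phi>\<close>, so does its inverse \<open>\<psi>'\<close>. Both \<open>\<psi>\<^sup>* y\<close> and \<open>\<psi>'\<^sup>* y\<close>
  are \<open>\<phi>\<^sup>*\<close>-invariant, so both lie in \<open>\<complex>(y)\<close>, and \<open>\<psi>\<^sup>*\<close> restricts to an automorphism of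
  \<open>\<complex>(y)\<close>. It remains to see that \<open>\<psi>\<^sup>* y\<close> is a Moebius transform of \<open>y\<close> over \<open>\<complex>\<close>, and that
  \<open>\<psi>\<^sup>* x\<close> is one of \<open>x\<close> over \<open>\<complex>(y)\<close>. Both are instances of one fact about a field \<open>k\<close>: an
  element \<open>f \<in> k(t)\<close> of which \<open>t\<close> is a rational function is a Moebius transform of \<open>t\<close>
  (\<open>generator_is_moebius\<close>), and this follows from the rational root theorem over \<open>k[t]\<close>.
\<close>

section \<open>Rational functions in one variable over a field\<close>

lemma fract_obtain:
  fixes z :: "'a::idom fract"
  obtains a b where "b \<noteq> 0" "z = to_fract a / to_fract b"
proof (cases z)
  case (Fract a b)
  then show ?thesis using that[of b a] by (simp add: Fract_conv_to_fract)
qed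

lemma rhom_constant_fract: "rhom (\<lambda>c::'a::idom. to_fract [:c:])"
proof -
  have "to_fract [:a + b:] = to_fract [:a:] + to_fract [:b:]"
    "to_fract [:a * b:] = to_fract [:a:] * to_fract [:b:]" for a b :: 'a
    by (simp_all flip: to_fract_add to_fract_mult)
  then show ?thesis unfolding rhom_def by (simp flip: one_pCons)
qed

lemma eval1_generator: "eval1 (\<lambda>c. to_fract [:c:]) (to_fract [:0, 1:]) p = to_fract p"
proof (induction p)
  case (pCons a p)
  have "pCons a p = [:a:] + [:0, 1:] * p" by simp
  then have "to_fract (pCons a p) = to_fract [:a:] + to_fract [:0, 1:] * to_fract p"
    by (metis to_fract_add to_fract_mult)
  then show ?case using pCons by (simp add: eval1_pCons rhom_constant_fract)
qed simp

lemma eval1_constant: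
  "eval1 (\<lambda>c. to_fract [:c:]) (to_fract [:l:]) p = to_fract [:poly p l:]"
  using rhomD[OF rhom_constant_fract[where 'a = 'a]]
  by (induction p) (simp_all add: eval1_pCons rhom_constant_fract)

text \<open>
  A nonzero element of least degree in the ideal \<open>(a, b)\<close> generates it, and dividing \<open>a\<close> and \<open>b\<close>
  by it makes them coprime. Coprimality is recorded as a Bezout identity, which makes sense over
  any coefficient field, in particular over \<open>\<complex>(y)\<close>.
\<close>

lemma fract_poly_coprime_obtain:
  fixes z :: "'a::field poly fract"
  obtains a b s t where "b \<noteq> 0" "z = to_fract a / to_fract b" "s * a + t * b = 1"
proof -
  obtain a b where ab: "b \<noteq> 0" "z = to_fract a / to_fract b"
    by (rule fract_obtain)
  let ?I = "\<lambda>g. g \<noteq> 0 \<and> (\<exists>s t. g = s * a + t * b)"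
  have "?I b" using ab by (auto intro: exI[of _ 0] exI[of _ 1])
  then obtain g where g: "?I g" and min: "\<And>h. ?I h \<Longrightarrow> degree g \<le> degree h"
    using ex_has_least_nat[of ?I b degree] by blast
  obtain s t where st: "g = s * a + t * b" using g by blast
  have dvd: "g dvd u" if "u = p * a + q * b" for u p q
  proof (rule ccontr)
    assume "\<not> g dvd u"
    then have nz: "u mod g \<noteq> 0" by (simp add: mod_eq_0_iff_dvd)
    have "u mod g = u - u div g * g" by (simp add: minus_div_mult_eq_mod)
    also have "\<dots> = (p - u div g * s) * a + (q - u div g * t) * b"
      by (subst (2) st) (simp add: that algebra_simps)
    finally have "degree g \<le> degree (u mod g)" using nz min by blast
    then show False using degree_mod_less[of g u] g nz by auto
  qed
  obtain a' b' where 1: "a = g * a'" "b = g * b'"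
    using dvd[of a 1 0] dvd[of b 0 1] by (auto elim!: dvdE)
  have "g * (s * a' + t * b') = g * 1" using st 1 by (simp add: algebra_simps)
  then have "s * a' + t * b' = 1" using g by (metis mult_cancel_left)
  moreover have "z = to_fract a' / to_fract b'" using ab 1 g by simp
  moreover have "b' \<noteq> 0" using ab 1 by auto
  ultimately show ?thesis using that by blast
qed

text \<open>
  One half of the rational root theorem: clearing denominators in \<open>N(a / b) = 0\<close> makes every term
  except \<open>lead_coeff N * a ^ degree N\<close> divisible by \<open>b\<close>, and \<open>b\<close> is coprime to \<open>a\<close>.
\<close>

lemma denominator_dvd_lead_coeff:
  fixes a b :: "'a::idom"
  assumes b: "b \<noteq> 0" and coprime: "s * a + t * b = 1"
    and root: "poly (map_poly to_fract N) (to_fract a / to_fract b) = 0"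
  shows "b dvd lead_coeff N"
proof -
  let ?n = "degree N"
  have power: "to_fract (u ^ k) = to_fract u ^ k" for u :: 'a and k
    by (induction k) simp_all
  have "eval1 to_fract (to_fract a / to_fract b) N = 0"
    using root by (simp add: eval1_def)
  then have "(\<Sum>i\<le>?n. to_fract (coeff N i) * (to_fract a / to_fract b) ^ i) = 0"
    by (simp add: eval1_altdef)
  then have "0 = to_fract b ^ ?n * (\<Sum>i\<le>?n. to_fract (coeff N i) * (to_fract a / to_fract b) ^ i)"
    by simp
  also have "\<dots> = (\<Sum>i\<le>?n. to_fract (coeff N i * a ^ i * b ^ (?n - i)))"
    unfolding sum_distrib_left
  proof (intro sum.cong refl, goal_cases)
    case (1 i)
    then have "to_fract b ^ ?n = to_fract b ^ i * to_fract b ^ (?n - i)"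
      by (simp flip: power_add)
    then show ?case using b by (simp add: power_divide power)
  qed
  also have "\<dots> = to_fract (\<Sum>i\<le>?n. coeff N i * a ^ i * b ^ (?n - i))"
    by (simp only: to_fract_sum)
  finally have "(\<Sum>i\<le>?n. coeff N i * a ^ i * b ^ (?n - i)) = 0"
    by (metis to_fract_eq_0_iff)
  then have sum: "lead_coeff N * a ^ ?n + (\<Sum>i<?n. coeff N i * a ^ i * b ^ (?n - i)) = 0"
    by (simp add: lessThan_Suc_atMost[symmetric] add.commute)
  have "b dvd (\<Sum>i<?n. coeff N i * a ^ i * b ^ (?n - i))"
    by (intro dvd_sum dvd_mult) (simp add: dvd_power)
  from dvd_add_left_iff[OF this, of "lead_coeff N * a ^ ?n"] have *: "b dvd lead_coeff N * a ^ ?n"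
    unfolding sum by simp
  have "b dvd e" if "b dvd e * a ^ n" for e n
    using that
  proof (induction n)
    case (Suc n)
    have "e * a ^ n = s * (e * a ^ Suc n) + b * (t * e * a ^ n)"
      using arg_cong[OF coprime, of "\<lambda>u. e * a ^ n * u"] by (simp add: algebra_simps)
    moreover have "b dvd s * (e * a ^ Suc n) + b * (t * e * a ^ n)"
      by (intro dvd_add dvd_mult Suc.prems dvd_triv_left)
    ultimately have "b dvd e * a ^ n" by (simp only:)
    then show ?case by (rule Suc.IH)
  qed simp
  from this[OF *] show ?thesis .
qed

text \<open>
  The other half, obtained from the first one applied to the reflected polynomial and its root
  \<open>b / a\<close>. The coefficient in question is the lowest nonzero one.
\<close>

lemma numerator_dvd_coeff:
  fixes a b :: "'a::idom"
  assumes b: "b \<noteq> 0" and coprime: "s * a + t * b = 1"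
    and root: "poly (map_poly to_fract N) (to_fract a / to_fract b) = 0"
    and N: "N \<noteq> 0" and a: "a \<noteq> 0"
  obtains i where "coeff N i \<noteq> 0" "a dvd coeff N i"
proof -
  have "degree (map_poly to_fract N) = degree N" by (rule degree_map_poly) simp
  then have "map_poly to_fract (reflect_poly N) = reflect_poly (map_poly to_fract N)"
    by (intro poly_eqI) (simp add: coeff_reflect_poly coeff_map_poly)
  then have "poly (map_poly to_fract (reflect_poly N)) (to_fract b / to_fract a) = 0"
    using root a b by (simp add: poly_reflect_poly_nz)
  moreover have "t * b + s * a = 1" using coprime by (simp add: add.commute)
  ultimately have "a dvd lead_coeff (reflect_poly N)"
    using denominator_dvd_lead_coeff a by blast
  moreover have "lead_coeff (reflect_poly N) \<noteq> 0" using N by simp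
  moreover have "lead_coeff (reflect_poly N) = 0 \<or>
      (\<exists>i. lead_coeff (reflect_poly N) = coeff N i)"
    by (subst (1 2) coeff_reflect_poly) auto
  ultimately show ?thesis using that by metis
qed

text \<open>
  Here \<open>x = c(f) / d(f)\<close>, so \<open>f\<close> is a root of the polynomial with coefficients
  \<open>c\<^sub>i - x d\<^sub>i\<close>, which have degree at most one in \<open>x\<close>. By the rational root theorem the
  coprime numerator and denominator of \<open>f\<close> each divide a nonzero coefficient of this kind, so they
  have degree at most one as well. The determinant vanishes only if \<open>f\<close> is a constant; but then \<open>x\<close>
  would be a constant.
\<close>

lemma generator_is_moebius:
  fixes f :: "'a::field poly fract" and c d :: "'a poly"
  defines "k \<equiv> \<lambda>l. to_fract [:l:]" and "x \<equiv> to_fract [:0, 1:]"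
  assumes d: "eval1 k f d \<noteq> 0" and eq: "eval1 k f c = x * eval1 k f d"
  obtains A B C D where "A * D - B * C \<noteq> 0" "f = (k A * x + k B) / (k C * x + k D)"
proof -
  have k: "rhom k" unfolding k_def by (rule rhom_constant_fract)
  obtain a b s t where ab: "b \<noteq> 0" "f = to_fract a / to_fract b" "s * a + t * b = 1"
    by (rule fract_poly_coprime_obtain)
  define N where "N = map_poly (\<lambda>l. [:l:]) c - smult [:0, 1:] (map_poly (\<lambda>l. [:l:]) d)"
  have N: "coeff N i = [:coeff c i, - coeff d i:]" for i
    by (simp add: N_def coeff_map_poly)
  have "N \<noteq> 0"
  proof
    assume "N = 0"
    then have "coeff d i = 0" for i using N[of i] by simp
    then have "d = 0" by (simp add: poly_eq_iff)
    with d show False by simp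
  qed
  have "map_poly to_fract N = map_poly k c - smult x (map_poly k d)"
  proof (intro poly_eqI)
    fix i
    have "[:coeff c i, - coeff d i:] = [:coeff c i:] - [:0, 1:] * [:coeff d i:]" by simp
    then have "to_fract [:coeff c i, - coeff d i:] = k (coeff c i) - x * k (coeff d i)"
      unfolding k_def x_def by (metis to_fract_diff to_fract_mult)
    then show "coeff (map_poly to_fract N) i = coeff (map_poly k c - smult x (map_poly k d)) i"
      using rhomD(1)[OF k] by (simp add: coeff_map_poly N)
  qed
  then have root: "poly (map_poly to_fract N) f = 0"
    using eq by (simp add: eval1_def)
  have deg: "degree u \<le> 1" if "u dvd coeff N i" "coeff N i \<noteq> 0" for u i
    using dvd_imp_degree_le[OF that] by (auto simp: N split: if_splits)
  have "degree b \<le> 1"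
    using denominator_dvd_lead_coeff[OF ab(1,3)] root ab(2) deg \<open>N \<noteq> 0\<close>
    by (metis leading_coeff_0_iff)
  have "degree a \<le> 1"
  proof (cases "a = 0")
    case False
    then show ?thesis
      using numerator_dvd_coeff[OF ab(1,3) _ \<open>N \<noteq> 0\<close> False] root ab(2) deg by metis
  qed simp
  have linear: "u = [:coeff u 0, coeff u 1:]" if "degree u \<le> 1" for u :: "'a poly"
    using that by (intro poly_eqI) (auto simp: coeff_pCons coeff_eq_0 split: nat.splits)
  obtain A B C D where AB: "a = [:B, A:]" "b = [:D, C:]"
    using linear[OF \<open>degree a \<le> 1\<close>] linear[OF \<open>degree b \<le> 1\<close>] by blast
  have to_fract_linear: "to_fract [:q, p:] = k p * x + k q" for p q
  proof -
    have "[:q, p:] = [:p:] * [:0, 1:] + [:q:]" by simp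
    then show ?thesis unfolding k_def x_def by (metis to_fract_add to_fract_mult)
  qed
  have "A * D - B * C \<noteq> 0"
  proof
    assume det: "A * D - B * C = 0"
    have const: "f \<noteq> k l" for l
    proof
      assume f: "f = k l"
      have "to_fract [:poly c l:] = to_fract ([:0, 1:] * [:poly d l:])"
        using eq unfolding f k_def x_def to_fract_mult by (simp only: eval1_constant)
      then have "[:poly c l:] = [:0, 1:] * [:poly d l:]" by (simp only: to_fract_eq_iff)
      then have "poly d l = 0" by simp
      then have "eval1 k f d = 0" unfolding f k_def by (simp add: eval1_constant)
      with d show False ..
    qed
    show False
    proof (cases "C = 0")
      case True
      then have "D \<noteq> 0" "A = 0" using ab(1) AB det by auto
      then have "a = [:B / D:] * b" using AB True by simp
      then have "to_fract a = k (B / D) * to_fract b" unfolding k_def by (metis to_fract_mult)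
      then show False using const[of "B / D"] ab by simp
    next
      case False
      then have "a = [:A / C:] * b" using AB det by (simp add: field_simps)
      then have "to_fract a = k (A / C) * to_fract b" unfolding k_def by (metis to_fract_mult)
      then show False using const[of "A / C"] ab by simp
    qed
  qed
  then show ?thesis using that ab(2) AB to_fract_linear by metis
qed


section \<open>Generation of the function field by the coordinates\<close>

lemma rhom_of_ratfun_y: "rhom of_ratfun_y"
  unfolding of_ratfun_y_def by (rule rhom_constant_fract)

lemma rhom_minus:
  assumes "rhom h" shows "h (a - b) = h a - h b"
  using rhomD(3)[OF assms, of "a - b" b] by simp

lemma rhom_field_eq_0_iff:
  fixes h :: "'a::field \<Rightarrow> 'b::idom"
  assumes "rhom h" shows "h a = 0 \<longleftrightarrow> a = 0"
proof
  assume "h a = 0"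
  then have "h (a * inverse a) = 0" by (simp add: rhomD(4)[OF assms])
  then show "a = 0" using rhomD(2)[OF assms] by (cases "a = 0") auto
qed (simp add: rhomD(1)[OF assms])

lemma rhom_field_inj:
  fixes h :: "'a::field \<Rightarrow> 'b::idom"
  assumes "rhom h" shows "h a = h b \<longleftrightarrow> a = b"
  using rhom_field_eq_0_iff[OF assms, of "a - b"] by (simp add: rhom_minus[OF assms])

lemma rhom_divide:
  fixes h :: "'a::field \<Rightarrow> 'b::field"
  assumes "rhom h" shows "h (a / b) = h a / h b"
proof (cases "b = 0")
  case False
  then have "h a = h (a / b) * h b" by (simp flip: rhomD(4)[OF assms])
  then show ?thesis using False rhom_field_eq_0_iff[OF assms] by (simp add: field_simps)
qed (simp add: rhomD(1)[OF assms])

lemma rhom_eval1_commute: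
  assumes h: "rhom h" and k: "rhom k"
  shows "h (eval1 k u p) = eval1 (\<lambda>c. h (k c)) (h u) p"
proof -
  have "rhom (\<lambda>c. h (k c))"
    using rhomD[OF h] rhomD[OF k] by (simp add: rhom_def)
  then show ?thesis
    using rhomD[OF h] by (induction p) (simp_all add: eval1_pCons k)
qed

lemma ratfun_y_altdef:
  obtains c d where "of_ratfun_y w = eval1 const_xy coord_y c / eval1 const_xy coord_y d"
proof -
  obtain c d where w: "w = to_fract c / to_fract d"
    by (rule fract_obtain)
  have "of_ratfun_y (to_fract p) = eval1 const_xy coord_y p" for p
    using rhom_eval1_commute[OF rhom_of_ratfun_y rhom_constant_fract, of "to_fract [:0, 1:]" p]
    by (simp add: eval1_generator const_xy_def[abs_def] const_y_def coord_y_def)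
  then have "of_ratfun_y w = eval1 const_xy coord_y c / eval1 const_xy coord_y d"
    unfolding w by (simp add: rhom_divide[OF rhom_of_ratfun_y])
  then show ?thesis by (rule that)
qed

text \<open>
  The constants and \<open>y\<close> generate \<open>\<complex>(y)\<close> as a field, and adding \<open>x\<close> gives \<open>\<complex>(x, y)\<close>. Cast as
  induction rules, these facts reduce statements about all functions to the coordinates.
\<close>

lemma of_ratfun_y_induct [case_names const y add mult divide]:
  assumes const: "\<And>c. P (const_xy c)" and y: "P coord_y"
    and add: "\<And>u v. P u \<Longrightarrow> P v \<Longrightarrow> P (u + v)"
    and mult: "\<And>u v. P u \<Longrightarrow> P v \<Longrightarrow> P (u * v)"
    and divide: "\<And>u v. P u \<Longrightarrow> P v \<Longrightarrow> v \<noteq> 0 \<Longrightarrow> P (u / v)"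
  shows "P (of_ratfun_y w)"
proof -
  have 0: "P 0" using const[of 0] rhomD(1)[OF rhom_const_xy] by simp
  have *: "P (eval1 const_xy coord_y p)" for p
    by (induction p) (auto simp: eval1_pCons rhom_const_xy intro: assms 0)
  obtain c d where cd: "of_ratfun_y w = eval1 const_xy coord_y c / eval1 const_xy coord_y d"
    using ratfun_y_altdef .
  then show ?thesis using divide[OF * *, of d c] 0 by (cases "eval1 const_xy coord_y d = 0") auto
qed

lemma eval1_coord_x: "eval1 of_ratfun_y coord_x p = to_fract p"
  unfolding of_ratfun_y_def[abs_def] coord_x_def by (rule eval1_generator)

lemma ratfun_xy_induct [case_names const x y add mult divide]:
  assumes const: "\<And>c. P (const_xy c)" and x: "P coord_x" and y: "P coord_y"
    and add: "\<And>u v. P u \<Longrightarrow> P v \<Longrightarrow> P (u + v)"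
    and mult: "\<And>u v. P u \<Longrightarrow> P v \<Longrightarrow> P (u * v)"
    and divide: "\<And>u v. P u \<Longrightarrow> P v \<Longrightarrow> v \<noteq> 0 \<Longrightarrow> P (u / v)"
  shows "P u"
proof -
  have 0: "P 0" using const[of 0] rhomD(1)[OF rhom_const_xy] by simp
  have "P (of_ratfun_y w)" for w
    using const y add mult divide by (rule of_ratfun_y_induct)
  then have "P (eval1 of_ratfun_y coord_x p)" for p
    by (induction p) (auto simp: eval1_pCons rhom_of_ratfun_y intro: add mult x 0)
  then have *: "P (to_fract p)" for p
    by (simp add: eval1_coord_x)
  obtain a b where "b \<noteq> 0" "u = to_fract a / to_fract b"
    by (rule fract_obtain)
  then show ?thesis using divide[OF * *, of b a] by simp
qed


section \<open>Pullback of rational functions\<close>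

lemma rhom_dehomogenize: "rhom dehomogenize"
  using rhom_eval3[OF rhom_const_xy] unfolding dehomogenize_def[abs_def] .

lemma dehomogenize_vars:
  "dehomogenize varX = coord_x" "dehomogenize varY = coord_y" "dehomogenize varZ = 1"
  by (simp_all add: dehomogenize_def eval3_vars rhom_const_xy)

lemma dehomogenize_const: "dehomogenize (const3 c) = const_xy c"
  by (simp add: dehomogenize_def eval3_const3 rhom_const_xy)

text \<open>
  A function on the plane is a quotient of forms of the same degree. Working with such quotients
  makes substitution of a birational triple meaningful without any discussion of vanishing
  denominators: a birational triple is dominant, so it sends nonzero forms to nonzero forms.
\<close>

definition homogeneous_fraction :: "poly3 \<Rightarrow> poly3 \<Rightarrow> ratfun_xy \<Rightarrow> bool" where
  "homogeneous_fraction A B u \<longleftrightarrow> (\<exists>d. homogeneous d A \<and> homogeneous d B) \<and> B \<noteq> 0 \<and>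
     dehomogenize A = u * dehomogenize B"

lemma homogeneous_fraction_nz:
  "homogeneous_fraction A B u \<Longrightarrow> dehomogenize B \<noteq> 0"
  using dehomogenize_eq_0 unfolding homogeneous_fraction_def by blast

lemma homogeneous_fraction_unique:
  "homogeneous_fraction A B u \<Longrightarrow> homogeneous_fraction A B v \<Longrightarrow> u = v"
  using homogeneous_fraction_nz unfolding homogeneous_fraction_def by (metis mult_cancel_right)

lemma homogeneous_fraction_const: "homogeneous_fraction (const3 c) 1 (const_xy c)"
  using homogeneous_const3 homogeneous_1 rhomD(2)[OF rhom_dehomogenize]
  by (auto simp: homogeneous_fraction_def dehomogenize_const)

lemma homogeneous_fraction_x: "homogeneous_fraction varX varZ coord_x"
  and homogeneous_fraction_y: "homogeneous_fraction varY varZ coord_y"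
proof -
  have "varZ \<noteq> 0" by (simp add: varZ_def)
  then show "homogeneous_fraction varX varZ coord_x" "homogeneous_fraction varY varZ coord_y"
    unfolding homogeneous_fraction_def dehomogenize_vars using homogeneous_vars by auto
qed

lemma homogeneous_fraction_add:
  assumes "homogeneous_fraction A B u" "homogeneous_fraction A' B' v"
  shows "homogeneous_fraction (A * B' + A' * B) (B * B') (u + v)"
proof -
  obtain d d' where "homogeneous d A" "homogeneous d B" "homogeneous d' A'" "homogeneous d' B'"
    using assms unfolding homogeneous_fraction_def by blast
  then have "homogeneous (d + d') (A * B' + A' * B)" "homogeneous (d + d') (B * B')"
    using homogeneous_mult[of d A d' B'] homogeneous_mult[of d' A' d B] homogeneous_mult[of d B d' B']
    by (simp_all add: homogeneous_add add.commute)
  then show ?thesis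
    using assms rhomD[OF rhom_dehomogenize]
    by (auto simp: homogeneous_fraction_def algebra_simps)
qed

lemma homogeneous_fraction_mult:
  assumes "homogeneous_fraction A B u" "homogeneous_fraction A' B' v"
  shows "homogeneous_fraction (A * A') (B * B') (u * v)"
proof -
  obtain d d' where "homogeneous d A" "homogeneous d B" "homogeneous d' A'" "homogeneous d' B'"
    using assms unfolding homogeneous_fraction_def by blast
  then have "homogeneous (d + d') (A * A')" "homogeneous (d + d') (B * B')"
    by (simp_all add: homogeneous_mult)
  then show ?thesis
    using assms rhomD[OF rhom_dehomogenize]
    by (auto simp: homogeneous_fraction_def algebra_simps)
qed

lemma homogeneous_fraction_inverse:
  assumes "homogeneous_fraction A B u" "u \<noteq> 0"
  shows "homogeneous_fraction B A (inverse u)"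
  using assms homogeneous_fraction_nz[OF assms(1)] rhomD(1)[OF rhom_dehomogenize]
  by (auto simp: homogeneous_fraction_def field_simps)

lemma homogeneous_fraction_exists: "\<exists>A B. homogeneous_fraction A B u"
proof (induction u rule: ratfun_xy_induct)
  case (divide u v)
  then show ?case
    using homogeneous_fraction_mult homogeneous_fraction_inverse by (metis divide_inverse)
qed (use homogeneous_fraction_const homogeneous_fraction_x homogeneous_fraction_y
    homogeneous_fraction_add homogeneous_fraction_mult in blast)+

text \<open>
  Both sides are forms of the same degree, and dehomogenization is injective on those. Hence two
  representations of the same function remain so after any substitution.
\<close>

lemma homogeneous_fraction_cross:
  assumes "homogeneous_fraction A B u" "homogeneous_fraction A' B' u"
  shows "A * B' = A' * B"
proof -
  obtain d d' where d: "homogeneous d A" "homogeneous d B" "homogeneous d' A'" "homogeneous d' B'"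
    using assms unfolding homogeneous_fraction_def by blast
  have "homogeneous (d' + d) (A' * B)" and AB: "homogeneous (d + d') (A * B')"
    using d by (simp_all add: homogeneous_mult)
  then have "homogeneous (d + d') (- (A' * B))"
    unfolding homogeneous_def by (simp add: add.commute)
  from homogeneous_add[OF AB this] have "homogeneous (d + d') (A * B' - A' * B)"
    by simp
  moreover have "dehomogenize (A * B' - A' * B) = 0"
    using assms by (simp add: rhom_minus[OF rhom_dehomogenize] rhomD[OF rhom_dehomogenize]
        homogeneous_fraction_def)
  ultimately show ?thesis using dehomogenize_eq_0 by (metis eq_iff_diff_eq_0)
qed

abbreviation subst_triple :: "triple \<Rightarrow> poly3 \<Rightarrow> poly3" where
  "subst_triple \<equiv> eval3 const3"

text \<open>
  For a birational triple the choice is between equal values: by cross-multiplication, all the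
  homogeneous fractions that represent \<open>u\<close> yield the same function after substitution.
\<close>

definition pullback_triple :: "triple \<Rightarrow> ratfun_xy \<Rightarrow> ratfun_xy" where
  "pullback_triple F u = (SOME v. \<exists>A B. homogeneous_fraction A B u \<and>
     homogeneous_fraction (subst_triple F A) (subst_triple F B) v)"

lemma homogeneous_fraction_subst_exists:
  assumes F: "birational_triple F" and u: "homogeneous_fraction A B u"
  shows "\<exists>v. homogeneous_fraction (subst_triple F A) (subst_triple F B) v"
proof -
  obtain d where d: "homogeneous d A" "homogeneous d B" "B \<noteq> 0"
    using u unfolding homogeneous_fraction_def by blast
  obtain e where e: "\<forall>P\<in>components F. homogeneous e P"
    using birational_rational[OF F] unfolding rational_triple_iff by blast
  have h: "homogeneous (d * e) (subst_triple F A)" "homogeneous (d * e) (subst_triple F B)"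
    using d e by (cases F; auto simp: homogeneous_eval3)+
  have "subst_triple F B \<noteq> 0"
    using birational_dominant[OF F] d unfolding dominant_triple_def by blast
  then have "homogeneous_fraction (subst_triple F A) (subst_triple F B)
      (dehomogenize (subst_triple F A) / dehomogenize (subst_triple F B))"
    using h dehomogenize_eq_0[OF h(2)] unfolding homogeneous_fraction_def by auto
  then show ?thesis ..
qed

lemma homogeneous_fraction_pullback_triple:
  assumes F: "birational_triple F" and u: "homogeneous_fraction A B u"
  shows "homogeneous_fraction (subst_triple F A) (subst_triple F B) (pullback_triple F u)"
proof -
  note subst = rhomD[OF rhom_eval3[OF rhom_const3], of F]
  obtain v where v: "homogeneous_fraction (subst_triple F A) (subst_triple F B) v"
    using homogeneous_fraction_subst_exists[OF assms] ..
  have "w = v" if w: "homogeneous_fraction A' B' u"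
    "homogeneous_fraction (subst_triple F A') (subst_triple F B') w" for A' B' w
  proof -
    have "subst_triple F (A * B') = subst_triple F (A' * B)"
      using homogeneous_fraction_cross[OF u w(1)] by simp
    then have "dehomogenize (subst_triple F A) * dehomogenize (subst_triple F B') =
        dehomogenize (subst_triple F A') * dehomogenize (subst_triple F B)"
      unfolding subst by (metis rhomD(4)[OF rhom_dehomogenize])
    then show ?thesis
      using v w(2) homogeneous_fraction_nz[OF v] homogeneous_fraction_nz[OF w(2)]
      by (auto simp: homogeneous_fraction_def)
  qed
  note unique = this
  have "pullback_triple F u = v"
    unfolding pullback_triple_def
  proof (rule some_equality)
    show "\<exists>A B. homogeneous_fraction A B u \<and>
        homogeneous_fraction (subst_triple F A) (subst_triple F B) v"
      using u v by blast
  qed (metis unique)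
  then show ?thesis using v by simp
qed

lemma pullback_triple_eqI:
  assumes "birational_triple F" "homogeneous_fraction A B u"
    "homogeneous_fraction (subst_triple F A) (subst_triple F B) v"
  shows "pullback_triple F u = v"
  by (rule homogeneous_fraction_unique[OF homogeneous_fraction_pullback_triple[OF assms(1,2)] assms(3)])

lift_definition pullback :: "bir_P2 \<Rightarrow> ratfun_xy \<Rightarrow> ratfun_xy" is pullback_triple
proof (intro ext)
  fix F G :: triple and u
  assume FG: "birational_triple F \<and> birational_triple G \<and> same_map F G"
  obtain A B where u: "homogeneous_fraction A B u"
    using homogeneous_fraction_exists by blast
  then obtain d where d: "homogeneous d A" "homogeneous d B"
    unfolding homogeneous_fraction_def by blast
  obtain a b where ab: "scale a F = scale b G" "a \<noteq> 0" "b \<noteq> 0"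
    using FG same_map_scaleE by metis
  have "a ^ d * subst_triple F P = b ^ d * subst_triple G P" if "homogeneous d P" for P
    using ab eval3_scale_triple[OF that] by metis
  then have "(a ^ d * subst_triple F A) * (b ^ d * subst_triple G B) =
      (b ^ d * subst_triple G A) * (a ^ d * subst_triple F B)"
    using d by metis
  then have "(a ^ d * b ^ d) * (subst_triple F A * subst_triple G B) =
      (a ^ d * b ^ d) * (subst_triple G A * subst_triple F B)"
    by (simp only: ac_simps)
  then have "subst_triple F A * subst_triple G B = subst_triple G A * subst_triple F B"
    using ab by (metis mult_eq_0_iff mult_cancel_left power_not_zero)
  then have "dehomogenize (subst_triple F A) * dehomogenize (subst_triple G B) =
      dehomogenize (subst_triple G A) * dehomogenize (subst_triple F B)"
    by (metis rhomD(4)[OF rhom_dehomogenize])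
  moreover have "homogeneous_fraction (subst_triple F A) (subst_triple F B) (pullback_triple F u)"
    "homogeneous_fraction (subst_triple G A) (subst_triple G B) (pullback_triple G u)"
    using FG u homogeneous_fraction_pullback_triple by blast+
  ultimately show "pullback_triple F u = pullback_triple G u"
    using homogeneous_fraction_nz by (auto simp: homogeneous_fraction_def)
qed

lemma rhom_pullback: "rhom (pullback \<phi>)"
proof transfer
  fix F :: triple
  assume "birational_triple F \<and> birational_triple F \<and> same_map F F"
  then have F: "birational_triple F" by blast
  note subst = rhomD[OF rhom_eval3[OF rhom_const3], of F]
  note eqI = pullback_triple_eqI[OF F] and pb = homogeneous_fraction_pullback_triple[OF F]
  have const: "pullback_triple F (const_xy c) = const_xy c" for c
    by (rule eqI[OF homogeneous_fraction_const])
      (simp add: eval3_const3 rhom_const3 subst homogeneous_fraction_const)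
  have "pullback_triple F (u + v) = pullback_triple F u + pullback_triple F v"
    "pullback_triple F (u * v) = pullback_triple F u * pullback_triple F v" for u v
  proof -
    obtain A B A' B' where *: "homogeneous_fraction A B u" "homogeneous_fraction A' B' v"
      using homogeneous_fraction_exists by metis
    show "pullback_triple F (u + v) = pullback_triple F u + pullback_triple F v"
      by (rule eqI[OF homogeneous_fraction_add[OF *]])
        (simp add: subst homogeneous_fraction_add[OF pb[OF *(1)] pb[OF *(2)]])
    show "pullback_triple F (u * v) = pullback_triple F u * pullback_triple F v"
      by (rule eqI[OF homogeneous_fraction_mult[OF *]])
        (simp add: subst homogeneous_fraction_mult[OF pb[OF *(1)] pb[OF *(2)]])
  qed
  then show "rhom (pullback_triple F)"
    using const[of 0] const[of 1] rhomD(1,2)[OF rhom_const_xy] by (simp add: rhom_def)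
qed

lemma pullback_const: "pullback \<phi> (const_xy c) = const_xy c"
proof transfer
  fix F :: triple and c
  assume "birational_triple F \<and> birational_triple F \<and> same_map F F"
  then show "pullback_triple F (const_xy c) = const_xy c"
    by (intro pullback_triple_eqI[OF _ homogeneous_fraction_const])
      (simp_all add: eval3_const3 rhom_const3 homogeneous_fraction_const rhomD(2)[OF rhom_eval3[OF rhom_const3]])
qed

lemma pullback_one: "pullback 1 u = u"
proof transfer
  fix u
  obtain A B where "homogeneous_fraction A B u"
    using homogeneous_fraction_exists by blast
  then show "pullback_triple id_triple u = u"
    by (intro pullback_triple_eqI[OF birational_id]) (simp_all add: eval3_id)
qed

lemma pullback_mult: "pullback (\<phi> * \<psi>) u = pullback \<psi> (pullback \<phi> u)"
proof transfer
  fix F G :: triple and u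
  assume "birational_triple F \<and> birational_triple F \<and> same_map F F"
    "birational_triple G \<and> birational_triple G \<and> same_map G G"
  then have F: "birational_triple F" and G: "birational_triple G" by blast+
  obtain A B where u: "homogeneous_fraction A B u"
    using homogeneous_fraction_exists by blast
  show "pullback_triple (comp_triple F G) u = pullback_triple G (pullback_triple F u)"
    by (rule pullback_triple_eqI[OF birational_comp[OF F G] u])
      (simp add: eval3_comp_triple homogeneous_fraction_pullback_triple F G u)
qed

text \<open>
  The coordinates \<open>x\<close> and \<open>y\<close> are the fractions \<open>X / Z\<close> and \<open>Y / Z\<close>.
\<close>

lemma affine_form_pullback: "affine_form \<phi> = (pullback \<phi> coord_x, pullback \<phi> coord_y)"
proof transfer
  fix F :: triple
  assume "birational_triple F \<and> birational_triple F \<and> same_map F F"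
  then have F: "birational_triple F" by blast
  obtain P Q R where PQR: "F = (P, Q, R)" by (cases F)
  have "homogeneous_fraction P R (pullback_triple F coord_x)"
    "homogeneous_fraction Q R (pullback_triple F coord_y)"
    using homogeneous_fraction_pullback_triple[OF F homogeneous_fraction_x]
      homogeneous_fraction_pullback_triple[OF F homogeneous_fraction_y]
    by (simp_all add: PQR eval3_vars rhom_const3)
  then show "affine_triple F = (pullback_triple F coord_x, pullback_triple F coord_y)"
    using homogeneous_fraction_nz by (fastforce simp: PQR homogeneous_fraction_def)
qed

text \<open>
  The equations \<open>P Z = X R\<close> and \<open>Q Z = Y R\<close> between forms are two of the three equations for
  equality with the identity map; the third one, \<open>P Y = X Q\<close>, follows upon cancelling \<open>Z\<close>.
\<close>

lemma affine_form_faithful: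
  assumes "affine_form \<phi> = (coord_x, coord_y)"
  shows "\<phi> = 1"
  using assms
proof transfer
  fix F :: triple
  assume "birational_triple F \<and> birational_triple F \<and> same_map F F"
    and *: "affine_triple F = (coord_x, coord_y)"
  then have F: "birational_triple F" by blast
  obtain P Q R where PQR: "F = (P, Q, R)" by (cases F)
  have R: "R \<noteq> 0" using birational_last_nz F PQR by blast
  obtain d where d: "homogeneous d P" "homogeneous d Q" "homogeneous d R"
    using birational_rational[OF F] by (auto simp: PQR)
  have nz: "dehomogenize R \<noteq> 0" using R d dehomogenize_eq_0 by blast
  then have "homogeneous_fraction P R coord_x" "homogeneous_fraction Q R coord_y"
    using * R d unfolding homogeneous_fraction_def by (auto simp: PQR field_simps)
  then have 1: "P * varZ = varX * R" "Q * varZ = varY * R"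
    using homogeneous_fraction_cross homogeneous_fraction_x homogeneous_fraction_y by blast+
  then have "varZ * (P * varY) = varZ * (varX * Q)"
    by (metis mult.commute mult.left_commute)
  then have "P * varY = varX * Q"
    by (metis mult_cancel_left homogeneous_fraction_x homogeneous_fraction_def)
  then have "same_map F id_triple"
    using 1 R homogeneous_fraction_x by (auto simp: PQR id_triple_def homogeneous_fraction_def)
  then show "birational_triple F \<and> birational_triple id_triple \<and> same_map F id_triple"
    using F birational_id by blast
qed


section \<open>Invariant functions and the centralizer\<close>

lemma pullback_of_ratfun_y_fixed:
  assumes "pullback \<phi> coord_y = coord_y"
  shows "pullback \<phi> (of_ratfun_y w) = of_ratfun_y w"
  by (rule of_ratfun_y_induct)
    (simp_all add: assms pullback_const rhomD[OF rhom_pullback] rhom_divide[OF rhom_pullback])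

lemma pullback_power_fixed:
  assumes "pullback \<phi> u = u"
  shows "pullback (\<phi> ^ k) u = u"
  by (induction k) (simp_all add: pullback_one pullback_mult assms)

text \<open>
  An invariant \<open>u\<close> outside \<open>\<complex>(y)\<close> makes \<open>x\<close> a root of a nonzero polynomial with coefficients
  in \<open>\<complex>(y)(u)\<close>. The powers of \<open>\<phi>\<^sup>*\<close> fix these coefficients, hence map \<open>x\<close> to roots of the
  same polynomial; so the orbit of \<open>x\<close> is finite, and a positive power of \<open>\<phi>\<^sup>*\<close> fixes both coordinates.
\<close>

lemma invariant_function_in_base:
  assumes y: "pullback \<phi> coord_y = coord_y" and np: "\<not> periodic \<phi>" and u: "pullback \<phi> u = u"
  obtains w where "u = of_ratfun_y w"
proof (rule ccontr)
  assume nex: "\<not> thesis"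
  obtain p q where pq: "q \<noteq> 0" "u = to_fract p / to_fract q"
    by (rule fract_obtain)
  let ?M = "map_poly of_ratfun_y p - smult u (map_poly of_ratfun_y q)"
  have coeffs: "coeff ?M i = of_ratfun_y (coeff p i) - u * of_ratfun_y (coeff q i)" for i
    using rhomD(1)[OF rhom_of_ratfun_y] by (simp add: coeff_map_poly)
  \<comment> \<open>Otherwise \<open>u\<close> is the quotient of two corresponding coefficients of \<open>p\<close> and \<open>q\<close>.\<close>
  have "?M \<noteq> 0"
  proof
    assume "?M = 0"
    then have lead: "of_ratfun_y (coeff p (degree q)) = u * of_ratfun_y (lead_coeff q)"
      using coeffs[of "degree q"] by simp
    have "of_ratfun_y (lead_coeff q) \<noteq> 0"
      using pq by (simp add: rhom_field_eq_0_iff[OF rhom_of_ratfun_y])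
    then have "u = of_ratfun_y (coeff p (degree q) / lead_coeff q)"
      using lead by (simp add: rhom_divide[OF rhom_of_ratfun_y])
    then show False using that nex by blast
  qed
  let ?h = "\<lambda>k. pullback (\<phi> ^ k)"
  have fixed: "?h k (of_ratfun_y w) = of_ratfun_y w" "?h k u = u" for k w
    by (intro pullback_of_ratfun_y_fixed pullback_power_fixed y u)+
  have eval: "eval1 of_ratfun_y (?h k coord_x) r = ?h k (to_fract r)" for k r
    using rhom_eval1_commute[OF rhom_pullback rhom_of_ratfun_y, of "\<phi> ^ k" coord_x r]
    by (simp add: fixed eval1_coord_x)
  have "poly ?M (?h k coord_x) = 0" for k
  proof -
    have "to_fract p = u * to_fract q" using pq by simp
    then have "?h k (to_fract p) = u * ?h k (to_fract q)"
      using rhomD(4)[OF rhom_pullback] fixed(2) by metis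
    then show ?thesis using eval by (simp add: eval1_def)
  qed
  then have "range (\<lambda>k. ?h k coord_x) \<subseteq> {z. poly ?M z = 0}" by (intro image_subsetI) simp
  then have "finite (range (\<lambda>k. ?h k coord_x))"
    by (rule finite_subset) (rule poly_roots_finite[OF \<open>?M \<noteq> 0\<close>])
  then have "\<not> inj (\<lambda>k. ?h k coord_x)"
    by (metis finite_imageD infinite_UNIV_nat)
  then obtain k l where kl: "k < l" "?h k coord_x = ?h l coord_x"
    unfolding inj_def by (metis linorder_neqE_nat)
  have "\<phi> ^ l = \<phi> ^ (l - k) * \<phi> ^ k" using kl(1) by (simp flip: power_add)
  then have "?h k coord_x = ?h k (?h (l - k) coord_x)"
    using kl(2) by (metis pullback_mult)
  then have "?h (l - k) coord_x = coord_x"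
    by (simp add: rhom_field_inj[OF rhom_pullback])
  moreover have "?h (l - k) coord_y = coord_y" by (intro pullback_power_fixed y)
  ultimately have "\<phi> ^ (l - k) = 1"
    by (intro affine_form_faithful) (simp add: affine_form_pullback)
  then show False using np kl(1) unfolding periodic_def by (metis zero_less_diff)
qed

text \<open>
  Applying \<open>\<psi>\<^sup>*\<close> to the expressions of \<open>\<psi>'\<^sup>* y\<close> and \<open>\<psi>'\<^sup>* x\<close> as rational functions
  gives \<open>y\<close> as a rational function of \<open>\<psi>\<^sup>* y\<close> over \<open>\<complex>\<close>, and \<open>x\<close> as a rational function of
  \<open>\<psi>\<^sup>* x\<close> over \<open>\<complex>(y)\<close>; in the second case \<open>\<psi>\<^sup>*\<close> also moves the coefficients, by an
  endomorphism \<open>\<sigma>\<close> of \<open>\<complex>(y)\<close>. So both images are Moebius transforms.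
\<close>

lemma base_preserving_in_de_Jonquieres:
  assumes \<psi>: "pullback \<psi> coord_y = of_ratfun_y r"
    and \<psi>': "pullback \<psi>' coord_y = of_ratfun_y s"
    and inv: "\<psi>' * \<psi> = 1"
  shows "\<psi> \<in> de_Jonquieres"
proof -
  have cancel: "pullback \<psi> (pullback \<psi>' u) = u" for u
    by (metis inv pullback_mult pullback_one)
  note hom = rhom_pullback[of \<psi>] and hom_divide = rhom_divide[OF rhom_pullback[of \<psi>]]
  have const_y: "rhom const_y"
    unfolding const_y_def[abs_def] by (rule rhom_constant_fract)
  have base: "pullback \<psi> (eval1 const_xy coord_y p) = of_ratfun_y (eval1 const_y r p)" for p
    using rhom_eval1_commute[OF hom rhom_const_xy, of coord_y p]
      rhom_eval1_commute[OF rhom_of_ratfun_y const_y, of r p]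
    by (simp add: \<psi> pullback_const[unfolded const_xy_def] const_xy_def[abs_def])
  have "\<exists>w'. pullback \<psi> (of_ratfun_y w) = of_ratfun_y w'" for w
  proof -
    obtain c d where "of_ratfun_y w = eval1 const_xy coord_y c / eval1 const_xy coord_y d"
      using ratfun_y_altdef .
    then show ?thesis by (metis hom_divide base rhom_divide[OF rhom_of_ratfun_y])
  qed
  then obtain \<sigma> where \<sigma>: "\<And>w. pullback \<psi> (of_ratfun_y w) = of_ratfun_y (\<sigma> w)"
    by metis
  have \<sigma>_0: "\<sigma> 0 = 0"
    using \<sigma>[of 0] rhomD(1)[OF hom] rhom_field_eq_0_iff[OF rhom_of_ratfun_y] by metis
  obtain a b c d where y: "a * d - b * c \<noteq> 0" "pullback \<psi> coord_y = moebius_y a b c d"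
  proof -
    obtain p q where pq: "of_ratfun_y s = eval1 const_xy coord_y p / eval1 const_xy coord_y q"
      using ratfun_y_altdef .
    have "coord_y \<noteq> 0" unfolding coord_y_def by (simp add: rhom_field_eq_0_iff[OF rhom_of_ratfun_y])
    have y: "coord_y = of_ratfun_y (eval1 const_y r p) / of_ratfun_y (eval1 const_y r q)"
      using cancel[of coord_y] by (simp add: \<psi>' pq hom_divide base)
    then have nz: "of_ratfun_y (eval1 const_y r q) \<noteq> 0" using \<open>coord_y \<noteq> 0\<close> by auto
    then have "of_ratfun_y (eval1 const_y r p) = coord_y * of_ratfun_y (eval1 const_y r q)"
      using y by (simp add: field_simps)
    then have eq: "eval1 const_y r p = to_fract [:0, 1:] * eval1 const_y r q"
      unfolding coord_y_def
      by (simp add: rhom_field_inj[OF rhom_of_ratfun_y] flip: rhomD(4)[OF rhom_of_ratfun_y])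
    have "eval1 const_y r q \<noteq> 0" using nz rhomD(1)[OF rhom_of_ratfun_y] by auto
    from this eq obtain a b c d where det: "a * d - b * c \<noteq> 0" and
      r: "r = (const_y a * to_fract [:0, 1:] + const_y b) / (const_y c * to_fract [:0, 1:] + const_y d)"
      unfolding const_y_def[abs_def] by (rule generator_is_moebius)
    have "of_ratfun_y r = moebius_y a b c d"
      by (simp add: r moebius_y_def const_xy_def coord_y_def
          rhom_divide[OF rhom_of_ratfun_y] rhomD[OF rhom_of_ratfun_y])
    then show ?thesis using that[OF det] \<psi> by simp
  qed
  obtain A B C D where x: "A * D - B * C \<noteq> 0" "pullback \<psi> coord_x = moebius_x A B C D"
  proof -
    obtain p q where pq: "q \<noteq> 0" "pullback \<psi>' coord_x = to_fract p / to_fract q"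
      by (rule fract_obtain)
    let ?f = "pullback \<psi> coord_x"
    have eval: "pullback \<psi> (to_fract g) = eval1 of_ratfun_y ?f (map_poly \<sigma> g)" for g
    proof -
      have "map_poly (\<lambda>w. of_ratfun_y (\<sigma> w)) g = map_poly of_ratfun_y (map_poly \<sigma> g)"
        by (rule poly_eqI) (simp add: coeff_map_poly \<sigma>_0 rhomD(1)[OF rhom_of_ratfun_y])
      then have "eval1 (\<lambda>w. of_ratfun_y (\<sigma> w)) ?f g = eval1 of_ratfun_y ?f (map_poly \<sigma> g)"
        by (simp add: eval1_def)
      then show ?thesis
        using rhom_eval1_commute[OF hom rhom_of_ratfun_y, of coord_x g]
        by (simp add: eval1_coord_x \<sigma>)
    qed
    have nz: "pullback \<psi> (to_fract q) \<noteq> 0"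
      using pq by (simp add: rhom_field_eq_0_iff[OF hom])
    have "coord_x = pullback \<psi> (to_fract p) / pullback \<psi> (to_fract q)"
      using cancel[of coord_x] by (simp add: pq hom_divide)
    then have eq: "eval1 of_ratfun_y ?f (map_poly \<sigma> p) = coord_x * eval1 of_ratfun_y ?f (map_poly \<sigma> q)"
      using nz by (simp add: eval field_simps)
    have "eval1 of_ratfun_y ?f (map_poly \<sigma> q) \<noteq> 0" using nz by (simp add: eval)
    from this eq obtain A B C D where "A * D - B * C \<noteq> 0"
      "?f = (of_ratfun_y A * coord_x + of_ratfun_y B) / (of_ratfun_y C * coord_x + of_ratfun_y D)"
      unfolding of_ratfun_y_def[abs_def] coord_x_def by (rule generator_is_moebius)
    then show ?thesis using that by (simp add: moebius_x_def)
  qed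
  show ?thesis
    unfolding de_Jonquieres_def mem_Collect_eq affine_form_pullback prod.inject using x y by blast
qed

theorem proposition4p1:
  fixes \<phi> :: bir_P2
  assumes "\<phi> \<in> de_Jonquieres0"
  shows "centralizer \<phi> \<subseteq> de_Jonquieres \<or> periodic \<phi>"
proof (cases "periodic \<phi>")
  case False
  have y: "pullback \<phi> coord_y = coord_y"
    using assms by (auto simp: de_Jonquieres0_def affine_form_pullback)
  have invariant: "pullback \<phi> (pullback \<psi> coord_y) = pullback \<psi> coord_y"
    if "\<psi> * \<phi> = \<phi> * \<psi>" for \<psi>
    using that y by (metis pullback_mult)
  have "\<psi> \<in> de_Jonquieres" if \<psi>: "\<psi> * \<phi> = \<phi> * \<psi>" for \<psi>
  proof -
    obtain \<psi>' where inv: "\<psi> * \<psi>' = 1" "\<psi>' * \<psi> = 1" using bir_P2_inverse by blast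
    have "\<psi>' * \<phi> = \<psi>' * (\<phi> * \<psi>) * \<psi>'" by (simp add: mult.assoc inv)
    also have "\<dots> = (\<psi>' * \<psi>) * \<phi> * \<psi>'" by (simp add: mult.assoc \<psi>[symmetric])
    finally have "\<psi>' * \<phi> = \<phi> * \<psi>'" by (simp add: inv)
    then obtain r s where "pullback \<psi> coord_y = of_ratfun_y r" "pullback \<psi>' coord_y = of_ratfun_y s"
      using invariant_function_in_base[OF y False invariant] \<psi> by metis
    then show ?thesis using inv(2) by (rule base_preserving_in_de_Jonquieres)
  qed
  then show ?thesis by (auto simp: centralizer_def)
qed simp

end
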